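(* Let $p$ be a prime of the form $p=6g+1$ or $p=6g-1$ with $g\ge 1$ an integer. For all integers $n\ge 0$, $k\ge 0$ and all integers $r$ with $1\le r\le p-1$, we have \[ \mathcal{EO}_u\left(4\left(p^{2k+2}n+p^{2k+1}r+\frac{p^{2k+2}-1}{24}\right)\right)\equiv 0 \pmod{2}. \]
   Context: For a positive integer $k$, let $f_k:=(q^k;q^k)_\infty=\prod_{i=1}^\infty(1-q^{ki})$. The integers $\mathcal{EO}_u(n)$, $n\ge 0$, are defined by $\sum_{n=0}^\infty \mathcal{EO}_u(n)q^n=\dfrac{f_4^2}{f_2^2}$. *)

theory Defs
  imports
    "HOL-Analysis.Infinite_Products"
    "HOL-Computational_Algebra.Formal_Power_Series"
    "HOL-Number_Theory.Cong"
begin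

text \<open>
  The series \<open>f\<^sub>k = (q\<^sup>k; q\<^sup>k)\<^sub>\<infinity>\<close>, as an element of \<open>\<int>[[q]]\<close>.  The infinite product is taken in
  the topology of formal power series.  The index \<open>i\<close> of the product starts at 0, hence \<open>Suc i\<close>.
\<close>
definition f_series :: "nat \<Rightarrow> int fps" where
  "f_series k = (\<Prod>i. 1 - fps_X ^ (k * Suc i))"

text \<open>
  The ring \<open>int\<close> has no \<open>inverse\<close>, so \<open>f\<^sub>4\<^sup>2 / f\<^sub>2\<^sup>2\<close> is formed with \<^term>\<open>fps_right_inverse\<close>, whose
  second argument is the inverse of the constant coefficient of its first argument; this
  coefficient is 1 here.  Lemma \<open>EO_u_series_quotient\<close> below confirms that this is the quotient.
\<close>
definition EO_u_series :: "int fps" where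
  "EO_u_series = f_series 4 ^ 2 * fps_right_inverse (f_series 2 ^ 2) 1"

definition EO_u :: "nat \<Rightarrow> int" where
  "EO_u n = fps_nth EO_u_series n"

lemma f_series_aux:
  assumes "k > 0"
  obtains F :: "int fps" where
    "(\<lambda>n. \<Prod>i\<le>n. 1 - fps_X ^ (k * Suc i)) \<longlonglongrightarrow> F" "fps_nth F 0 = 1"
proof -
  define P :: "nat \<Rightarrow> int fps" where "P = (\<lambda>n. \<Prod>i\<le>n. 1 - fps_X ^ (k * Suc i))"
  define F where "F = Abs_fps (\<lambda>m. fps_nth (P m) m)"
  have step: "fps_nth (P (Suc n)) m = fps_nth (P n) m" if "n \<ge> m" for n m
  proof -
    have "m < Suc (Suc n)"
      using that by simp
    also have "Suc (Suc n) \<le> k * Suc (Suc n)"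
      using assms by (cases k) simp_all
    finally have "m < k * Suc (Suc n)" .
    moreover have "P (Suc n) = P n - P n * fps_X ^ (k * Suc (Suc n))"
      by (simp add: P_def algebra_simps)
    ultimately show ?thesis
      by (simp only: fps_sub_nth fps_X_power_mult_right_nth if_True diff_zero)
  qed
  have const: "fps_nth (P n) m = fps_nth F m" if "n \<ge> m" for n m
    using that by (induction n rule: dec_induct) (simp_all add: F_def step)
  have "P \<longlonglongrightarrow> F"
    unfolding tendsto_fps_iff using const by (auto simp: eventually_sequentially)
  moreover have "fps_nth F 0 = 1"
    using assms by (simp add: F_def P_def)
  ultimately show ?thesis
    using that[of F] by (simp add: P_def)
qed

lemma has_prod_f_series:
  assumes "k > 0"
  shows "(\<lambda>i. 1 - fps_X ^ (k * Suc i) :: int fps) has_prod f_series k"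
    and "fps_nth (f_series k) 0 = 1"
proof -
  obtain F :: "int fps" where F:
    "(\<lambda>n. \<Prod>i\<le>n. 1 - fps_X ^ (k * Suc i)) \<longlonglongrightarrow> F" "fps_nth F 0 = 1"
    using f_series_aux[OF assms] by blast
  have "F \<noteq> 0"
    using F(2) by auto
  with F(1) have *: "(\<lambda>i. 1 - fps_X ^ (k * Suc i)) has_prod F"
    by (simp add: has_prod_def raw_has_prod_def)
  have nz: "1 - fps_X ^ (k * Suc i) \<noteq> (0 :: int fps)" for i
  proof
    assume "1 - fps_X ^ (k * Suc i) = (0 :: int fps)"
    hence "fps_nth (1 - fps_X ^ (k * Suc i) :: int fps) 0 = fps_nth 0 0"
      by simp
    thus False
      using assms by simp
  qed
  have "f_series k = F"
    unfolding f_series_def prodinf_def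
  proof (rule the_equality)
    fix G :: "int fps"
    assume "(\<lambda>i. 1 - fps_X ^ (k * Suc i)) has_prod G"
    hence "(\<lambda>n. \<Prod>i\<le>n. 1 - fps_X ^ (k * Suc i)) \<longlonglongrightarrow> G"
      unfolding has_prod_def raw_has_prod_def using nz by auto
    thus "G = F"
      using F(1) LIMSEQ_unique by blast
  qed (rule *)
  with * F(2) show "(\<lambda>i. 1 - fps_X ^ (k * Suc i) :: int fps) has_prod f_series k"
    and "fps_nth (f_series k) 0 = 1"
    by auto
qed

lemma EO_u_series_quotient: "EO_u_series * f_series 2 ^ 2 = f_series 4 ^ 2"
proof -
  have "fps_nth (f_series 2 ^ 2) 0 = 1"
    by (simp add: power2_eq_square has_prod_f_series(2))
  hence "f_series 2 ^ 2 * fps_right_inverse (f_series 2 ^ 2) 1 = 1"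
    by (intro fps_right_inverse) simp
  moreover have "A * B * C = A" if "C * B = 1" for A B C :: "int fps"
    using that by (metis mult.assoc mult.commute mult_1_right)
  ultimately show ?thesis
    unfolding EO_u_series_def by blast
qed

lemma index_div_exact:
  fixes p g k :: nat
  assumes "g \<ge> 1" and "p = 6 * g + 1 \<or> p = 6 * g - 1"
  shows "24 dvd p ^ (2 * k + 2) - 1"
proof -
  have "p mod 24 \<in> {1, 5, 7, 11, 13, 17, 19, 23}"
  proof -
    obtain h where h: "p = 6 * h + 1 \<or> p = 6 * h + 5"
    proof (cases "p = 6 * g + 1")
      case False
      with assms have "p = 6 * (g - 1) + 5"
        by linarith
      thus ?thesis
        using that by blast
    qed (use that in blast)
    define j where "j = h div 4"
    have "h mod 4 < 4" and "h = 4 * j + h mod 4"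
      by (simp_all add: j_def)
    hence "h = 4 * j \<or> h = 4 * j + 1 \<or> h = 4 * j + 2 \<or> h = 4 * j + 3"
      by linarith
    hence "p = 24 * j + 1 \<or> p = 24 * j + 5 \<or> p = 24 * j + 7 \<or> p = 24 * j + 11 \<or>
        p = 24 * j + 13 \<or> p = 24 * j + 17 \<or> p = 24 * j + 19 \<or> p = 24 * j + 23"
      using h by auto
    thus ?thesis
      by auto
  qed
  moreover have "p ^ 2 mod 24 = (p mod 24) ^ 2 mod 24"
    by (simp add: power_mod)
  ultimately have "[p ^ 2 = 1] (mod 24)"
    by (auto simp: cong_def)
  hence "[(p ^ 2) ^ (k + 1) = 1 ^ (k + 1)] (mod 24)"
    by (rule cong_pow)
  hence "[p ^ (2 * k + 2) = 1] (mod 24)"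
    by (simp only: power_mult [symmetric] power_one distrib_left mult_1_right)
  thus ?thesis
    by (metis cong_to_1_nat)
qed

end

theory Submission
  imports Defs "HOL-Library.Nat_Bijection"
begin

text \<open>
  Modulo 2 we have \<open>f\<^sub>2\<^sup>2 \<equiv> f\<^sub>4\<close>, so \<open>f\<^sub>4\<^sup>2 / f\<^sub>2\<^sup>2 \<equiv> f\<^sub>4\<close>.  By Euler's pentagonal number theorem
  the coefficient of \<open>q\<close> to the power \<open>4m\<close> in \<open>f\<^sub>4\<close> vanishes unless \<open>24m + 1\<close> is a square.
  For the given index \<open>24m + 1\<close> is exactly divisible by an odd power of \<open>p\<close>, so it is not a square.
  The pentagonal number theorem is obtained from the finite identity of D. Shanks
  (A short proof of an identity of Euler, 1951).
\<close>

text \<open>The product over \<open>{s<..n}\<close> is the quotient P_n / P_s of the partial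
  products P_j = (1 - x) ... (1 - x^j), written without division so that it makes sense in every
  commutative ring.\<close>

definition shanks_term :: "'a :: comm_ring_1 \<Rightarrow> nat \<Rightarrow> nat \<Rightarrow> 'a" where
  "shanks_term x n s = (-1) ^ s * (\<Prod>i\<in>{s<..n}. 1 - x ^ i) * x ^ (s * n + triangle s)"

text \<open>The differences between levels \<open>Suc n\<close> and \<open>n\<close> telescope,
  leaving a single remainder. At \<open>m = n\<close> its product is empty, and it becomes one of
  the two new pentagonal powers.\<close>

lemma sum_shanks_term_Suc_partial:
  fixes x :: "'a :: comm_ring_1"
  assumes "m \<le> n"
  shows "(\<Sum>s\<le>m. shanks_term x (Suc n) s) = (\<Sum>s\<le>m. shanks_term x n s)
    - (-1) ^ m * (\<Prod>i\<in>{m<..n}. 1 - x ^ i) * x ^ (Suc m * Suc n + triangle m)"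
  using assms
proof (induction m)
  case 0
  have "{0<..Suc n} = insert (Suc n) {0<..n}"
    by auto
  thus ?case
    by (simp add: shanks_term_def algebra_simps)
next
  case (Suc m)
  define D where "D = (\<Prod>i\<in>{Suc m<..n}. 1 - x ^ i)"
  have "{m<..n} = insert (Suc m) {Suc m<..n}"
    using Suc.prems by auto
  hence D1: "(\<Prod>i\<in>{m<..n}. 1 - x ^ i) = (1 - x ^ Suc m) * D"
    by (simp add: D_def)
  have "{Suc m<..Suc n} = insert (Suc n) {Suc m<..n}"
    using Suc.prems by auto
  hence D2: "(\<Prod>i\<in>{Suc m<..Suc n}. 1 - x ^ i) = (1 - x ^ Suc n) * D"
    by (simp add: D_def)
  have IH: "(\<Sum>s\<le>m. shanks_term x (Suc n) s) = (\<Sum>s\<le>m. shanks_term x n s)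
    - (-1) ^ m * ((1 - x ^ Suc m) * D) * x ^ (Suc m * Suc n + triangle m)"
    using Suc D1 by simp
  \<comment> \<open>All exponents are expressed through that of \<open>y\<close>, using
    \<open>triangle (Suc m) = triangle m + Suc m\<close>. The terms in \<open>x ^ Suc m * y\<close>
    without the factor \<open>x ^ Suc n\<close> then cancel.\<close>
  define y where "y = x ^ (Suc m * n + triangle (Suc m))"
  have e1: "x ^ (Suc m * Suc n + triangle m) = y"
    unfolding y_def by (rule arg_cong[of _ _ "power x"]) simp
  have e2: "x ^ (Suc m * Suc n + triangle (Suc m)) = x ^ Suc m * y"
    unfolding y_def power_add[symmetric] by (rule arg_cong[of _ _ "power x"]) simp
  have e3: "x ^ (Suc (Suc m) * Suc n + triangle (Suc m)) = x ^ Suc n * (x ^ Suc m * y)"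
    unfolding y_def power_add[symmetric] by (rule arg_cong[of _ _ "power x"]) simp
  have t1: "shanks_term x (Suc n) (Suc m)
      = (-1) ^ Suc m * ((1 - x ^ Suc n) * D) * (x ^ Suc m * y)"
    unfolding shanks_term_def D2 e2 ..
  have t2: "shanks_term x n (Suc m) = (-1) ^ Suc m * D * y"
    unfolding shanks_term_def D_def y_def ..
  show ?case
    unfolding sum.atMost_Suc IH t1 t2 e1 e3 D_def[symmetric]
    by (simp add: algebra_simps del: power_Suc) (simp add: algebra_simps)
qed

theorem shanks_identity:
  fixes x :: "'a :: comm_ring_1"
  shows "(\<Sum>s\<le>n. shanks_term x n s) =
    1 + (\<Sum>s<n. (-1) ^ Suc s * (x ^ (Suc s ^ 2 + triangle s) + x ^ (Suc s ^ 2 + triangle (Suc s))))"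
proof (induction n)
  case 0
  show ?case
    by (simp add: shanks_term_def)
next
  case (Suc n)
  \<comment> \<open>The remainder at \<open>m = n\<close> gives the power with
    \<open>triangle n\<close>; the extra term \<open>s = Suc n\<close>, whose product is empty,
    gives the one with \<open>triangle (Suc n)\<close>.\<close>
  show ?case
    using sum_shanks_term_Suc_partial[of n n x]
    by (simp add: Suc.IH shanks_term_def[of x "Suc n" "Suc n"] power2_eq_square algebra_simps)
qed

text \<open>With j = s + 1 the exponents are the generalized pentagonal numbers j(3j - 1)/2 and j(3j
  + 1)/2, so completing the square yields (6j - 1)^2 and (6j + 1)^2.\<close>

lemma pentagonal_square:
  "24 * (Suc s ^ 2 + triangle s) + 1 = (6 * s + 5) ^ 2"
  "24 * (Suc s ^ 2 + triangle (Suc s)) + 1 = (6 * s + 7) ^ 2"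
proof -
  have "2 * triangle s = s * Suc s"
    by (simp add: triangle_def)
  thus "24 * (Suc s ^ 2 + triangle s) + 1 = (6 * s + 5) ^ 2"
    "24 * (Suc s ^ 2 + triangle (Suc s)) + 1 = (6 * s + 7) ^ 2"
    by (simp_all add: power2_eq_square algebra_simps)
qed

text \<open>Convergence of formal power series makes each coefficient eventually constant, and
  finitely many coefficients stabilise together. Factors in powers of \<open>fps_X ^ k\<close> match
  the finite identity at \<open>x = fps_X ^ k\<close>.\<close>

lemma f_series_partial_product:
  assumes "k > 0"
  shows "\<forall>\<^sub>F n in sequentially. \<forall>j\<le>m.
    fps_nth (f_series k) j = fps_nth (\<Prod>i\<in>{0<..n}. 1 - (fps_X ^ k) ^ i) j"
proof -
  have "(\<lambda>n. \<Prod>i\<le>n. 1 - fps_X ^ (k * Suc i) :: int fps) \<longlonglongrightarrow> f_series k"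
    using has_prod_f_series(1)[OF assms] by (rule has_prod_imp_tendsto)
  hence "\<forall>\<^sub>F n in sequentially.
      fps_nth (\<Prod>i\<le>n. 1 - fps_X ^ (k * Suc i)) j = fps_nth (f_series k) j" for j
    unfolding tendsto_fps_iff by blast
  hence "\<forall>\<^sub>F n in sequentially. \<forall>j\<in>{..m}.
      fps_nth (\<Prod>i\<le>n. 1 - fps_X ^ (k * Suc i)) j = fps_nth (f_series k) j"
    by (intro eventually_ball_finite) auto
  moreover have "(\<Prod>i\<le>n. 1 - fps_X ^ (k * Suc i) :: int fps)
      = (\<Prod>i\<in>{0<..Suc n}. 1 - (fps_X ^ k) ^ i)" for n
    by (rule prod.reindex_bij_witness[of _ "\<lambda>i. i - 1" Suc]) (auto simp: power_mult power_add)
  ultimately have "\<forall>\<^sub>F n in sequentially. \<forall>j\<le>m.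
      fps_nth (f_series k) j = fps_nth (\<Prod>i\<in>{0<..Suc n}. 1 - (fps_X ^ k) ^ i) j"
    by (simp only: eq_commute[of "fps_nth (f_series k) j" for j] Ball_def atMost_iff)
  thus ?thesis
    by (subst (asm) eventually_sequentially_Suc)
qed

text \<open>For large \<open>n\<close> the left side of the finite identity has the same coefficient
  at \<open>m\<close> as \<open>f_series k\<close>, so a nonzero coefficient must come from a
  pentagonal power on the right.\<close>

lemma f_series_nth_nonzero:
  assumes "k > 0" and "fps_nth (f_series k) m \<noteq> 0"
  obtains e t where "m = k * e" "24 * e + 1 = t ^ 2"
proof -
  define x :: "int fps" where "x = fps_X ^ k"
  have x_nth: "fps_nth (x ^ a) j = (if j = k * a then 1 else 0)" for a j
    by (simp add: x_def power_mult[symmetric] fps_X_power_nth)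
  obtain n where n: "n \<ge> m" "fps_nth (f_series k) m = fps_nth (\<Prod>i\<in>{0<..n}. 1 - x ^ i) m"
    using eventually_conj[OF f_series_partial_product[OF assms(1), of m] eventually_ge_at_top[of m]]
    by (auto simp: x_def eventually_sequentially)
  have "fps_nth (shanks_term x n s) m = 0" if "s > 0" for s
  proof -
    \<comment> \<open>Since \<open>n \<ge> m\<close>, the power of \<open>x\<close> in a term with
      \<open>s > 0\<close> lies beyond degree \<open>m\<close>; only \<open>s = 0\<close>, the
      partial product, contributes.\<close>
    have "s * n \<ge> n" "triangle s > 0"
      using that by (simp, cases s) auto
    hence "m < s * n + triangle s"
      using n(1) by linarith
    also have "\<dots> \<le> k * (s * n + triangle s)"
      using assms(1) by simp
    finally show ?thesis
      by (simp add: shanks_term_def x_def power_mult[symmetric] fps_X_power_mult_right_nth)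
  qed
  hence "fps_nth (\<Sum>s\<le>n. shanks_term x n s) m = fps_nth (shanks_term x n 0) m"
    by (subst sum.atMost_shift) (simp add: fps_sum_nth)
  also have "\<dots> = fps_nth (f_series k) m"
    by (simp add: n(2) shanks_term_def)
  finally have nz: "fps_nth (1 + (\<Sum>s<n. (-1) ^ Suc s *
      (x ^ (Suc s ^ 2 + triangle s) + x ^ (Suc s ^ 2 + triangle (Suc s))))) m \<noteq> 0"
    using assms(2) unfolding shanks_identity by metis
  show ?thesis
  proof (cases "m = 0")
    \<comment> \<open>The summand 1 belongs to the pentagonal number 0, with 24 * 0 + 1 =
      1^2.\<close>
    case True
    show ?thesis
      by (rule that[of 0 1]) (simp_all add: True)
  next
    case False
    with nz have "(\<Sum>s<n. fps_nth ((-1) ^ Suc s *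
        (x ^ (Suc s ^ 2 + triangle s) + x ^ (Suc s ^ 2 + triangle (Suc s)))) m) \<noteq> 0"
      by (simp add: fps_sum_nth)
    then obtain s where "fps_nth ((-1) ^ Suc s *
        (x ^ (Suc s ^ 2 + triangle s) + x ^ (Suc s ^ 2 + triangle (Suc s)))) m \<noteq> 0"
      by (meson sum.not_neutral_contains_not_neutral)
    hence "fps_nth (x ^ (Suc s ^ 2 + triangle s) + x ^ (Suc s ^ 2 + triangle (Suc s))) m \<noteq> 0"
      by (cases "even s") (simp_all del: triangle_Suc power_Suc add: minus_one_power_iff)
    hence "m = k * (Suc s ^ 2 + triangle s) \<or> m = k * (Suc s ^ 2 + triangle (Suc s))"
      unfolding fps_add_nth x_nth by presburger
    thus ?thesis
      using that pentagonal_square by blast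
  qed
qed

lemma fps_even_iff: "(2 :: int fps) dvd A \<longleftrightarrow> (\<forall>n. even (fps_nth A n))"
proof
  assume "2 dvd A"
  then obtain B where "A = 2 * B" ..
  thus "\<forall>n. even (fps_nth A n)"
    by (simp add: fps_numeral_fps_const)
next
  assume "\<forall>n. even (fps_nth A n)"
  hence "A = 2 * Abs_fps (\<lambda>n. fps_nth A n div 2)"
    by (intro fps_ext) (simp add: fps_numeral_fps_const)
  thus "2 dvd A" ..
qed

text \<open>Factor by factor, (1 - y)^2 - (1 - y^2) = 2(y^2 - y).\<close>

lemma two_dvd_prod_one_minus_square:
  fixes x :: "'a :: comm_ring_1"
  assumes "finite I"
  shows "2 dvd (\<Prod>i\<in>I. 1 - x ^ i) ^ 2 - (\<Prod>i\<in>I. 1 - (x ^ 2) ^ i)"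
  using assms
proof induction
  case (insert j I)
  let ?P = "\<Prod>i\<in>I. 1 - x ^ i" and ?Q = "\<Prod>i\<in>I. 1 - (x ^ 2) ^ i"
  have "(x ^ 2) ^ j = (x ^ j) ^ 2"
    by (simp add: power_mult[symmetric] mult.commute)
  hence "(\<Prod>i\<in>insert j I. 1 - x ^ i) ^ 2 - (\<Prod>i\<in>insert j I. 1 - (x ^ 2) ^ i)
      = (1 - x ^ j) ^ 2 * (?P ^ 2 - ?Q) + 2 * (((x ^ j) ^ 2 - x ^ j) * ?Q)"
    using insert.hyps by (simp add: power2_eq_square algebra_simps)
  thus ?case
    using insert.IH by (metis dvd_add dvd_mult dvd_triv_left)
qed simp

lemma two_dvd_f_series_square:
  assumes "k > 0"
  shows "2 dvd f_series k ^ 2 - f_series (2 * k)"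
  unfolding fps_even_iff
proof
  fix m
  define P Q :: "nat \<Rightarrow> int fps"
    where "P = (\<lambda>n. \<Prod>i\<in>{0<..n}. 1 - (fps_X ^ k) ^ i)"
      and "Q = (\<lambda>n. \<Prod>i\<in>{0<..n}. 1 - (fps_X ^ (2 * k)) ^ i)"
  \<comment> \<open>Coefficient \<open>m\<close> of a square involves only coefficients up to
    \<open>m\<close>, so one \<open>n\<close> at which both products have stabilised that far
    suffices.\<close>
  obtain n where P: "\<forall>j\<le>m. fps_nth (f_series k) j = fps_nth (P n) j"
    and Q: "\<forall>j\<le>m. fps_nth (f_series (2 * k)) j = fps_nth (Q n) j"
    using eventually_conj[OF f_series_partial_product[of k m] f_series_partial_product[of "2 * k" m]]
      assms by (auto simp: P_def Q_def eventually_sequentially)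
  have "2 dvd P n ^ 2 - Q n"
    using two_dvd_prod_one_minus_square[of "{0<..n}" "fps_X ^ k :: int fps"]
    by (simp add: P_def Q_def power_mult[symmetric] mult_ac)
  moreover have "fps_nth (f_series k ^ 2) m = fps_nth (P n ^ 2) m"
    unfolding power2_eq_square fps_mult_nth using P by (intro sum.cong) auto
  ultimately show "even (fps_nth (f_series k ^ 2 - f_series (2 * k)) m)"
    using Q by (simp add: fps_even_iff)
qed

text \<open>Multiplied by \<open>f_series 4\<close>, the difference becomes a multiple of
  \<open>f_series 2 ^ 2 - f_series 4\<close>, which is even; \<open>f_series 4\<close> has constant
  term 1 and so can be cancelled.\<close>

lemma EO_u_cong_f_series_4: "[EO_u n = fps_nth (f_series 4) n] (mod 2)"
proof -
  define R where "R = fps_right_inverse (f_series 4) 1"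
  have R: "f_series 4 * R = 1"
    unfolding R_def by (rule fps_right_inverse) (simp add: has_prod_f_series(2))
  have "EO_u_series - f_series 4 = (EO_u_series - f_series 4) * (f_series 4 * R)"
    by (simp add: R)
  also have "\<dots> = (EO_u_series * f_series 4 - f_series 4 ^ 2) * R"
    by (simp add: power2_eq_square algebra_simps)
  also have "\<dots> = (f_series 2 ^ 2 - f_series 4) * (- EO_u_series * R)"
    unfolding EO_u_series_quotient[symmetric] by (simp add: algebra_simps)
  finally have "2 dvd EO_u_series - f_series 4"
    using two_dvd_f_series_square[of 2] by simp
  thus ?thesis
    by (simp add: fps_even_iff cong_iff_dvd_diff EO_u_def)
qed

text \<open>The exponent of \<open>p\<close> is odd on the left and even in any nonzero
  square.\<close>

lemma odd_prime_power_mult_not_square: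
  fixes p c t :: nat
  assumes "prime p" and "\<not> p dvd c"
  shows "p ^ (2 * k + 1) * c \<noteq> t ^ 2"
proof
  assume eq: "p ^ (2 * k + 1) * c = t ^ 2"
  have "c \<noteq> 0"
    using assms(2) by (metis dvd_0_right)
  hence "t \<noteq> 0"
    using eq assms(1) by (intro notI) simp
  have "multiplicity p (p ^ (2 * k + 1) * c) = 2 * k + 1"
    using assms by (intro multiplicity_decomposeI[of _ _ _ c]) (auto simp: prime_gt_0_nat)
  moreover have "multiplicity p (t ^ 2) = 2 * multiplicity p t"
    using assms(1) \<open>t \<noteq> 0\<close> by (simp add: prime_elem_multiplicity_power_distrib)
  ultimately have "2 * k + 1 = 2 * multiplicity p t"
    by (simp only: eq)
  thus False
    by presburger
qed

theorem theorem3p3: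
  fixes p g n k r :: nat
  assumes "prime p"
    and "g \<ge> 1"
    and "p = 6 * g + 1 \<or> p = 6 * g - 1"
    and "1 \<le> r" and "r \<le> p - 1"
  shows "[EO_u (4 * (p ^ (2 * k + 2) * n + p ^ (2 * k + 1) * r + (p ^ (2 * k + 2) - 1) div 24)) = 0] (mod 2)"
proof -
  define m where "m = p ^ (2 * k + 2) * n + p ^ (2 * k + 1) * r + (p ^ (2 * k + 2) - 1) div 24"
  \<comment> \<open>This is the cofactor left when \<open>p ^ (2 * k + 1)\<close> is taken out of
    \<open>24 * m + 1\<close>; modulo \<open>p\<close> it is \<open>24 * r\<close>.\<close>
  define c where "c = 24 * r + p * (24 * n + 1)"
  have "p \<ge> 5"
    using assms(2,3) by auto
  have "p ^ (2 * k + 2) \<ge> 1"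
    using \<open>p \<ge> 5\<close> by simp
  hence "24 * ((p ^ (2 * k + 2) - 1) div 24) + 1 = p ^ (2 * k + 2)"
    using index_div_exact[OF assms(2,3)] by simp
  hence "24 * m + 1 = 24 * (p ^ (2 * k + 2) * n + p ^ (2 * k + 1) * r) + p ^ (2 * k + 2)"
    unfolding m_def by simp
  also have "\<dots> = p ^ (2 * k + 1) * c"
    by (simp add: c_def algebra_simps)
  finally have m: "24 * m + 1 = p ^ (2 * k + 1) * c" .
  \<comment> \<open>24 is factored so that primality reduces the claim to 2, 3 and \<open>r\<close>,
    all positive and smaller than \<open>p\<close>.\<close>
  have "\<not> p dvd 2 ^ 3 * 3 * r"
  proof
    assume "p dvd 2 ^ 3 * 3 * r"
    hence "p dvd 2 \<or> p dvd 3 \<or> p dvd r"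
      using assms(1) by (metis prime_dvd_mult_iff prime_dvd_power)
    thus False
      using \<open>p \<ge> 5\<close> assms(4,5) by (auto dest!: dvd_imp_le)
  qed
  hence "\<not> p dvd c"
    by (simp add: c_def dvd_add_left_iff)
  hence "24 * m + 1 \<noteq> t ^ 2" for t
    unfolding m by (rule odd_prime_power_mult_not_square[OF assms(1)])
  hence "fps_nth (f_series 4) (4 * m) = 0"
    by (metis f_series_nth_nonzero mult_left_cancel zero_less_numeral zero_neq_numeral)
  thus ?thesis
    using EO_u_cong_f_series_4[of "4 * m"] by (simp add: m_def)
qed

end
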